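(* Let $\mathcal{D}$ be a $2-(v,k,1)$ design with $k\geq4$, let $r=\frac{v-1}{k-1}$, and let $\mathcal{S}$ be an Erdős-Ko-Rado set on $\mathcal{D}$. If $k^{2}-k\geq r\geq k^{2}-3k+\frac{3}{4}\sqrt{k}+2$, then $|\mathcal{S}|\leq r$. If moreover $(r,k)\neq(8,4)$, then equality $|\mathcal{S}|=r$ is obtained if and only if $\mathcal{S}$ is a point-pencil.
   Context: A $2-(v,k,1)$ design, with integers $v>k>1$, consists of a set $\mathcal{P}$ of $v$ points together with a set $\mathcal{B}$ of $k$-subsets of $\mathcal{P}$ (blocks) such that any two distinct points are contained in exactly one block. Every point then lies on exactly $r=\frac{v-1}{k-1}$ blocks. An Erdős-Ko-Rado set on a design is a set of pairwise intersecting blocks. A point-pencil is the set of all blocks through a fixed point. *)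

theory Defs
  imports Complex_Main
begin

definition is_2_design :: "nat \<Rightarrow> nat \<Rightarrow> 'a set \<Rightarrow> 'a set set \<Rightarrow> bool" where
  "is_2_design v k P Bs \<longleftrightarrow>
     1 < k \<and> k < v \<and> finite P \<and> card P = v \<and>
     (\<forall>B\<in>Bs. B \<subseteq> P \<and> card B = k) \<and>
     (\<forall>x\<in>P. \<forall>y\<in>P. x \<noteq> y \<longrightarrow> (\<exists>!B. B \<in> Bs \<and> x \<in> B \<and> y \<in> B))"

definition erdos_ko_rado_set :: "'a set set \<Rightarrow> 'a set set \<Rightarrow> bool" where
  "erdos_ko_rado_set Bs S \<longleftrightarrow> S \<subseteq> Bs \<and> pairwise (\<lambda>A B. A \<inter> B \<noteq> {}) S"

definition point_pencil :: "'a set set \<Rightarrow> 'a \<Rightarrow> 'a set set" where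
  "point_pencil Bs p = {B \<in> Bs. p \<in> B}"

end

theory Submission
  imports Defs
begin

text \<open>Let \<open>S\<close> be an intersecting family of \<open>s \<ge> r\<close> blocks not contained in a pencil, covering \<open>N\<close>
  points, and let \<open>q = k - 1\<close>. The \<open>r\<close> blocks through an uncovered point partition the covered
  points, so they contain many pairs of covered points that lie on no block of \<open>S\<close>. Counting over
  all uncovered points gives \<open>2 (N - r) (v - N) \<le> (k - 2) (N (N - 1) - s k (k - 1))\<close>. Every point
  lies on at most \<open>k\<close> blocks of \<open>S\<close>. If some point attains \<open>k\<close>, then \<open>N = q\<^sup>2 + q + 1\<close> and the
  inequality leaves only \<open>(r, k) = (8, 4)\<close> with \<open>s = 8\<close>. Otherwise put \<open>y = q - q\<^sup>2 + s\<close>;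
  convexity gives \<open>y N \<le> s (y + 1)\<close>, and the inequality reduces to
  \<open>y\<^sup>2 (2 q + 1 - y) \<le> q (q + 1)\<close>, which \<open>y \<ge> 3/4 sqrt k\<close> excludes.\<close>

section \<open>Incidence counts in a 2-design\<close>

locale two_design =
  fixes v k :: nat and P :: "'a set" and Bs :: "'a set set"
  assumes design: "is_2_design v k P Bs"
begin

lemma k_gt_1: "1 < k" and k_less_v: "k < v" and finite_P: "finite P" and card_P: "card P = v"
  using design by (auto simp: is_2_design_def)

lemma block_subset: "B \<in> Bs \<Longrightarrow> B \<subseteq> P" and card_block: "B \<in> Bs \<Longrightarrow> card B = k"
  using design by (auto simp: is_2_design_def)

lemma finite_block: "B \<in> Bs \<Longrightarrow> finite B"
  using block_subset finite_P finite_subset by blast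

lemma finite_Bs: "finite Bs"
  using finite_P block_subset by (meson Pow_iff finite_Pow_iff finite_subset subsetI)

lemma unique_block: "x \<in> P \<Longrightarrow> y \<in> P \<Longrightarrow> x \<noteq> y \<Longrightarrow> \<exists>!B. B \<in> Bs \<and> x \<in> B \<and> y \<in> B"
  using design by (auto simp: is_2_design_def)

lemma block_eqI:
  assumes "A \<in> Bs" "B \<in> Bs" "x \<in> A \<inter> B" "y \<in> A \<inter> B" "x \<noteq> y"
  shows "A = B"
  using unique_block[of x y] assms block_subset by blast

text \<open>Each point of \<open>A\<close> shares exactly one block with \<open>x\<close>, so the
  blocks through \<open>x\<close> cut \<open>A\<close> into disjoint pieces.\<close>

lemma sum_card_inter_star:
  assumes "x \<in> P" "A \<subseteq> P" "x \<notin> A"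
  shows "(\<Sum>T | T \<in> Bs \<and> x \<in> T. card (A \<inter> T)) = card A"
proof -
  have fin: "finite A" "finite {T \<in> Bs. x \<in> T}"
    using assms finite_P finite_Bs by (auto intro: finite_subset)
  have one: "card {T \<in> {T \<in> Bs. x \<in> T}. y \<in> T} = 1" if "y \<in> A" for y
  proof -
    have "y \<in> P" "x \<noteq> y" using that assms by auto
    then obtain B where B: "B \<in> Bs" "x \<in> B" "y \<in> B"
      and uniq: "\<And>C. C \<in> Bs \<and> x \<in> C \<and> y \<in> C \<Longrightarrow> C = B"
      using unique_block[OF \<open>x \<in> P\<close>] by (metis (no_types))
    have "{T \<in> {T \<in> Bs. x \<in> T}. y \<in> T} = {B}" using B uniq by blast
    then show ?thesis by simp
  qed
  have "(\<Sum>T | T \<in> Bs \<and> x \<in> T. card (A \<inter> T))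
      = (\<Sum>T\<in>{T \<in> Bs. x \<in> T}. \<Sum>y\<in>{y. y \<in> A \<and> y \<in> T}. 1)"
    by (simp add: Int_def)
  also have "\<dots> = (\<Sum>y\<in>A. \<Sum>T\<in>{T. T \<in> {T \<in> Bs. x \<in> T} \<and> y \<in> T}. 1)"
    using fin by (intro sum.swap_restrict[symmetric])
  also have "\<dots> = (\<Sum>y\<in>A. 1)" using one by (intro sum.cong) auto
  finally show ?thesis by simp
qed

lemma card_star:
  assumes "x \<in> P"
  shows "card {T \<in> Bs. x \<in> T} * (k - 1) = v - 1"
proof -
  have "card (P - {x}) = (\<Sum>T | T \<in> Bs \<and> x \<in> T. card ((P - {x}) \<inter> T))"
    using sum_card_inter_star[of x "P - {x}"] assms by simp
  also have "\<dots> = (\<Sum>T | T \<in> Bs \<and> x \<in> T. k - 1)"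
  proof (intro sum.cong refl)
    fix T assume T: "T \<in> {T \<in> Bs. x \<in> T}"
    then have "(P - {x}) \<inter> T = T - {x}" using block_subset by blast
    then show "card ((P - {x}) \<inter> T) = k - 1" using T card_block by simp
  qed
  finally show ?thesis using assms card_P by simp
qed

text \<open>The number r of blocks through a point; by \<open>card_star\<close> the division is
  exact.\<close>

definition rep :: nat where "rep = (v - 1) div (k - 1)"

lemma card_star_eq: "x \<in> P \<Longrightarrow> card {T \<in> Bs. x \<in> T} = rep"
  unfolding rep_def using card_star k_gt_1
  by (metis nonzero_mult_div_cancel_right not_less_iff_gr_or_eq zero_less_diff)

lemma P_nonempty: "P \<noteq> {}"
  using card_P k_less_v by auto

lemma rep_mult: "rep * (k - 1) = v - 1"
  using card_star card_star_eq P_nonempty by (metis ex_in_conv)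

lemma v_eq: "int v = int rep * (int k - 1) + 1"
proof -
  have "int (rep * (k - 1)) = int (v - 1)" using rep_mult by simp
  then show ?thesis using k_gt_1 k_less_v by (simp add: of_nat_diff)
qed

lemma sum_inter_pred_star:
  assumes "x \<in> P" "X \<subseteq> P" "x \<notin> X"
  shows "(\<Sum>T | T \<in> Bs \<and> x \<in> T. int (card (X \<inter> T)) - 1) = int (card X) - int rep"
proof -
  have "(\<Sum>T | T \<in> Bs \<and> x \<in> T. int (card (X \<inter> T))) = int (card X)"
    using sum_card_inter_star[OF assms] by (metis of_nat_sum)
  then show ?thesis using card_star_eq[OF assms(1)] by (simp add: sum_subtractf)
qed

text \<open>Here \<open>x\<close> lies in every intersection, so subtracting 1 removes exactly
  \<open>x\<close>, and the star partitions the remaining points of \<open>X\<close>.\<close>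

lemma sum_inter_pred_star_mem:
  assumes "X \<subseteq> P" "x \<in> X"
  shows "(\<Sum>T | T \<in> Bs \<and> x \<in> T. int (card (X \<inter> T)) - 1) = int (card X) - 1"
proof -
  have fin: "finite X" using assms finite_P finite_subset by blast
  have "card X \<ge> 1" using assms fin by (metis One_nat_def Suc_leI card_gt_0_iff empty_iff)
  have "(\<Sum>T | T \<in> Bs \<and> x \<in> T. int (card (X \<inter> T)) - 1)
      = (\<Sum>T | T \<in> Bs \<and> x \<in> T. int (card ((X - {x}) \<inter> T)))"
  proof (intro sum.cong refl)
    fix T assume "T \<in> {T \<in> Bs. x \<in> T}"
    then have "X \<inter> T = insert x ((X - {x}) \<inter> T)" using assms by auto
    then have "card (X \<inter> T) = Suc (card ((X - {x}) \<inter> T))"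
      using fin by (metis DiffD2 IntD1 card_insert_disjoint finite_Diff finite_Int insertI1)
    then show "int (card (X \<inter> T)) - 1 = int (card ((X - {x}) \<inter> T))" by simp
  qed
  also have "\<dots> = int (\<Sum>T | T \<in> Bs \<and> x \<in> T. card ((X - {x}) \<inter> T))" by simp
  also have "(\<Sum>T | T \<in> Bs \<and> x \<in> T. card ((X - {x}) \<inter> T)) = card (X - {x})"
    using assms by (intro sum_card_inter_star) auto
  finally show ?thesis using assms fin \<open>card X \<ge> 1\<close> by (simp add: of_nat_diff)
qed

text \<open>Ordered pairs of distinct points of \<open>X\<close> are sorted by the block joining
  them.\<close>

lemma sum_inter_pairs:
  assumes "X \<subseteq> P"
  shows "(\<Sum>T\<in>Bs. int (card (X \<inter> T)) * (int (card (X \<inter> T)) - 1)) = int (card X) * (int (card X) - 1)"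
proof -
  have fin: "finite X" using assms finite_P finite_subset by blast
  have "(\<Sum>T\<in>Bs. int (card (X \<inter> T)) * (int (card (X \<inter> T)) - 1))
      = (\<Sum>T\<in>Bs. \<Sum>x\<in>{x. x \<in> X \<and> x \<in> T}. int (card (X \<inter> T)) - 1)"
    by (simp add: Int_def)
  also have "\<dots> = (\<Sum>x\<in>X. \<Sum>T | T \<in> Bs \<and> x \<in> T. int (card (X \<inter> T)) - 1)"
    using fin finite_Bs by (intro sum.swap_restrict[symmetric])
  also have "\<dots> = (\<Sum>x\<in>X. int (card X) - 1)"
    using sum_inter_pred_star_mem[OF assms] by (intro sum.cong) auto
  finally show ?thesis by simp
qed

text \<open>A block contributes its weight \<open>card (X \<inter> T) - 1\<close> once for each of
  its points outside \<open>X\<close>. Regrouped by these points, the weights have the same sum at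
  each, by \<open>sum_inter_pred_star\<close>.\<close>

lemma sum_inter_outside:
  assumes "X \<subseteq> P"
  shows "(\<Sum>T\<in>Bs. (int k - int (card (X \<inter> T))) * (int (card (X \<inter> T)) - 1))
    = (int v - int (card X)) * (int (card X) - int rep)"
proof -
  have fin: "finite X" "finite (P - X)" using assms finite_P finite_subset by blast+
  have "(\<Sum>T\<in>Bs. (int k - int (card (X \<inter> T))) * (int (card (X \<inter> T)) - 1))
      = (\<Sum>T\<in>Bs. \<Sum>x\<in>{x. x \<in> P - X \<and> x \<in> T}. int (card (X \<inter> T)) - 1)"
  proof (intro sum.cong refl)
    fix T assume T: "T \<in> Bs"
    have "{x. x \<in> P - X \<and> x \<in> T} = T - X \<inter> T" using block_subset[OF T] by auto
    moreover have "int (card (T - X \<inter> T)) = int k - int (card (X \<inter> T))"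
      using card_block[OF T] finite_block[OF T]
      by (metis Int_lower2 card_Diff_subset card_mono finite_Int of_nat_diff)
    ultimately show "(int k - int (card (X \<inter> T))) * (int (card (X \<inter> T)) - 1)
        = (\<Sum>x\<in>{x. x \<in> P - X \<and> x \<in> T}. int (card (X \<inter> T)) - 1)"
      by simp
  qed
  also have "\<dots> = (\<Sum>x\<in>P - X. \<Sum>T | T \<in> Bs \<and> x \<in> T. int (card (X \<inter> T)) - 1)"
    using fin finite_Bs by (intro sum.swap_restrict[symmetric])
  also have "\<dots> = (\<Sum>x\<in>P - X. int (card X) - int rep)"
    using sum_inter_pred_star[OF _ assms] by (intro sum.cong) auto
  also have "\<dots> = int (card (P - X)) * (int (card X) - int rep)" by simp
  also have "int (card (P - X)) = int v - int (card X)"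
    using card_Diff_subset[OF fin(1) assms] card_mono[OF finite_P assms] card_P by simp
  finally show ?thesis .
qed

text \<open>A block outside \<open>S\<close> with \<open>a\<close> covered points satisfies
  \<open>2 (k - a) (a - 1) \<le> (k - 2) a (a - 1)\<close>, because \<open>(a - 1) (a - 2) \<ge> 0\<close> for integers.\<close>

lemma outside_points_bound:
  assumes "S \<subseteq> Bs"
  defines "N \<equiv> int (card (\<Union>S))"
  shows "2 * (N - int rep) * (int v - N)
    \<le> (int k - 2) * (N * (N - 1) - int (card S) * int k * (int k - 1))"
proof -
  let ?a = "\<lambda>T. int (card (\<Union>S \<inter> T))"
  \<comment> \<open>A block of \<open>S\<close> has all \<open>k\<close> points covered, so its left
    side is 0; subtracting \<open>?g\<close> makes its right side 0 as well.\<close>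
  let ?g = "\<lambda>T. if T \<in> S then int k * (int k - 1) else 0"
  have sub: "\<Union>S \<subseteq> P" using assms block_subset by blast
  have "2 * ((int k - ?a T) * (?a T - 1)) \<le> (int k - 2) * (?a T * (?a T - 1) - ?g T)"
    if T: "T \<in> Bs" for T
  proof (cases "T \<in> S")
    case True
    then have "\<Union>S \<inter> T = T" by blast
    then show ?thesis using True card_block[OF T] by simp
  next
    case False
    have "(int k - 2) * (?a T * (?a T - 1)) - 2 * ((int k - ?a T) * (?a T - 1))
        = int k * ((?a T - 1) * (?a T - 2))" by (simp add: algebra_simps)
    moreover have "(?a T - 1) * (?a T - 2) \<ge> 0"
    proof (cases "?a T \<ge> 2")
      case True then show ?thesis by simp
    next
      case False
      then have "?a T = 0 \<or> ?a T = 1" by linarith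
      then show ?thesis by auto
    qed
    ultimately show ?thesis using False by (smt (verit) mult_nonneg_nonneg of_nat_0_le_iff)
  qed
  then have "(\<Sum>T\<in>Bs. 2 * ((int k - ?a T) * (?a T - 1)))
      \<le> (\<Sum>T\<in>Bs. (int k - 2) * (?a T * (?a T - 1) - ?g T))"
    by (rule sum_mono)
  also have "\<dots> = (int k - 2) * ((\<Sum>T\<in>Bs. ?a T * (?a T - 1)) - (\<Sum>T\<in>Bs. ?g T))"
    by (simp only: sum_distrib_left[symmetric] sum_subtractf)
  also have "(\<Sum>T\<in>Bs. ?g T) = int (card S) * int k * (int k - 1)"
    using assms(1) finite_Bs by (simp add: sum.If_cases Int_absorb1 mult.assoc flip: Int_def)
  also have "(\<Sum>T\<in>Bs. 2 * ((int k - ?a T) * (?a T - 1))) = 2 * (\<Sum>T\<in>Bs. (int k - ?a T) * (?a T - 1))"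
    by (simp only: sum_distrib_left[symmetric])
  finally show ?thesis
    unfolding sum_inter_outside[OF sub] sum_inter_pairs[OF sub] N_def
    by (simp only: mult_ac)
qed

end

section \<open>Degrees and covered points of an intersecting family\<close>

locale intersecting_family = two_design +
  fixes S :: "'a set set"
  assumes ekr: "erdos_ko_rado_set Bs S"
begin

definition deg :: "'a \<Rightarrow> nat" where "deg p = card {B \<in> S. p \<in> B}"

lemma S_subset: "S \<subseteq> Bs" and S_inter: "A \<in> S \<Longrightarrow> B \<in> S \<Longrightarrow> A \<noteq> B \<Longrightarrow> A \<inter> B \<noteq> {}"
  using ekr by (auto simp: erdos_ko_rado_set_def pairwise_def)

lemma finite_S: "finite S"
  using S_subset finite_Bs finite_subset by blast

lemma covered_subset: "\<Union>S \<subseteq> P"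
  using S_subset block_subset by blast

lemma finite_covered: "finite (\<Union>S)"
  using covered_subset finite_P finite_subset by blast

lemma card_inter_blocks:
  assumes "A \<in> S" "B \<in> S" "A \<noteq> B"
  shows "card (A \<inter> B) = 1"
proof -
  obtain x where x: "x \<in> A \<inter> B" using S_inter[OF assms] by blast
  have "A \<inter> B = {x}" using x block_eqI[of A B x] assms S_subset by blast
  then show ?thesis by simp
qed

text \<open>Two blocks of \<open>S\<close> through \<open>p\<close> cannot meet \<open>B\<close> in
  the same point: that point differs from \<open>p\<close>, so the blocks would coincide.\<close>

lemma deg_bound_witness:
  assumes "B \<in> S" "p \<notin> B"
  obtains f where "inj_on f {A \<in> S. p \<in> A}" "\<And>A. A \<in> S \<Longrightarrow> p \<in> A \<Longrightarrow> f A \<in> A \<inter> B"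
proof -
  have "\<exists>x. x \<in> A \<inter> B" if "A \<in> S" "p \<in> A" for A
    using S_inter[of A B] that assms by blast
  then obtain f where f: "\<And>A. A \<in> S \<Longrightarrow> p \<in> A \<Longrightarrow> f A \<in> A \<inter> B" by metis
  have "inj_on f {A \<in> S. p \<in> A}"
  proof (rule inj_onI)
    fix A C assume "A \<in> {A \<in> S. p \<in> A}" "C \<in> {A \<in> S. p \<in> A}" "f A = f C"
    then show "A = C"
      using f[of A] f[of C] assms S_subset by (intro block_eqI[of A C p "f A"]) auto
  qed
  then show thesis using f that by blast
qed

lemma deg_le:
  assumes "B \<in> S" "p \<notin> B"
  shows "deg p \<le> k"
proof -
  obtain f where f: "inj_on f {A \<in> S. p \<in> A}" "\<And>A. A \<in> S \<Longrightarrow> p \<in> A \<Longrightarrow> f A \<in> A \<inter> B"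
    using deg_bound_witness[OF assms] by blast
  have "B \<in> Bs" using assms S_subset by blast
  moreover have "f ` {A \<in> S. p \<in> A} \<subseteq> B" using f(2) by blast
  ultimately show ?thesis
    using f(1) finite_block card_block unfolding deg_def by (metis card_inj_on_le)
qed

lemma sum_covered_deg:
  fixes g :: "'a \<Rightarrow> int"
  shows "(\<Sum>p\<in>\<Union>S. int (deg p) * g p) = (\<Sum>B\<in>S. \<Sum>p\<in>B. g p)"
proof -
  have "(\<Sum>p\<in>\<Union>S. int (deg p) * g p) = (\<Sum>p\<in>\<Union>S. \<Sum>B | B \<in> S \<and> p \<in> B. g p)"
    by (simp add: deg_def)
  also have "\<dots> = (\<Sum>B\<in>S. \<Sum>p | p \<in> \<Union>S \<and> p \<in> B. g p)"
    using finite_covered finite_S by (rule sum.swap_restrict)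
  also have "\<dots> = (\<Sum>B\<in>S. \<Sum>p\<in>B. g p)"
  proof (intro sum.cong refl)
    show "{p. p \<in> \<Union>S \<and> p \<in> B} = B" if "B \<in> S" for B using that by blast
  qed
  finally show ?thesis .
qed

text \<open>Counted by blocks of \<open>S\<close>: \<open>B\<close> itself contributes
  \<open>k\<close>, every other block contributes its single point on \<open>B\<close>.\<close>

lemma sum_deg_block:
  assumes "B \<in> S"
  shows "(\<Sum>p\<in>B. int (deg p)) = int (card S) - 1 + int k"
proof -
  have B: "B \<in> Bs" using assms S_subset by blast
  have "(\<Sum>p\<in>B. int (deg p)) = (\<Sum>p\<in>B. \<Sum>A | A \<in> S \<and> p \<in> A. 1)"
    by (simp add: deg_def)
  also have "\<dots> = (\<Sum>A\<in>S. \<Sum>p | p \<in> B \<and> p \<in> A. 1)"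
    using finite_S finite_block[OF B] by (intro sum.swap_restrict)
  also have "\<dots> = (\<Sum>A\<in>S. int (card (A \<inter> B)))"
    by (intro sum.cong refl) (simp add: Int_def conj_commute)
  also have "\<dots> = int (card (B \<inter> B)) + (\<Sum>A\<in>S - {B}. int (card (A \<inter> B)))"
    using assms finite_S by (rule sum.remove[rotated])
  also have "(\<Sum>A\<in>S - {B}. int (card (A \<inter> B))) = (\<Sum>A\<in>S - {B}. 1)"
    using card_inter_blocks assms by (intro sum.cong) auto
  also have "\<dots> = int (card S) - 1"
  proof -
    have "card S \<ge> 1" using assms finite_S by (metis One_nat_def Suc_leI card_gt_0_iff empty_iff)
    then show ?thesis using assms finite_S by (simp add: of_nat_diff)
  qed
  finally show ?thesis using card_block[OF B] by simp
qed

text \<open>The \<open>k\<close> blocks of \<open>S\<close> through \<open>p\<close> meet any other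
  block of \<open>S\<close> in \<open>k\<close> different points, hence in all of it. So they alone
  cover everything, and they pairwise share only \<open>p\<close>.\<close>

lemma card_covered_of_deg_k:
  assumes "deg p = k" "B \<in> S" "p \<notin> B"
  shows "int (card (\<Union>S)) = int k * (int k - 1) + 1"
proof -
  let ?Sp = "{A \<in> S. p \<in> A}"
  have cov: "x \<in> \<Union>?Sp" if x: "x \<in> L" "L \<in> S" for x L
  proof (cases "p \<in> L")
    case True
    then show ?thesis using x by blast
  next
    case False
    obtain f where f: "inj_on f ?Sp" "\<And>A. A \<in> S \<Longrightarrow> p \<in> A \<Longrightarrow> f A \<in> A \<inter> L"
      using deg_bound_witness[OF x(2) False] by blast
    have L: "L \<in> Bs" using x S_subset by blast
    have "f ` ?Sp \<subseteq> L" using f(2) by blast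
    moreover have "card (f ` ?Sp) = card L"
      using card_image[OF f(1)] assms(1) card_block[OF L] by (simp add: deg_def)
    ultimately have "f ` ?Sp = L" using finite_block[OF L] by (intro card_subset_eq)
    then obtain A where A: "A \<in> ?Sp" "x = f A" using x(1) by auto
    then show ?thesis using f(2)[of A] by blast
  qed
  have "?Sp \<noteq> {}"
  proof
    assume "?Sp = {}"
    then have "deg p = 0" by (simp only: deg_def card.empty)
    then show False using assms(1) k_gt_1 by simp
  qed
  then have U: "\<Union>S = insert p (\<Union>A\<in>?Sp. A - {p})"
  proof (intro equalityI subsetI)
    fix x assume "x \<in> \<Union>S"
    then show "x \<in> insert p (\<Union>A\<in>?Sp. A - {p})" using cov by fastforce
  qed auto
  have fin: "finite ?Sp" "\<And>A. A \<in> ?Sp \<Longrightarrow> finite (A - {p})"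
    using finite_S S_subset finite_block by auto
  have "card (\<Union>A\<in>?Sp. A - {p}) = (\<Sum>A\<in>?Sp. card (A - {p}))"
  proof (rule card_UN_disjoint)
    show "\<forall>A\<in>?Sp. \<forall>C\<in>?Sp. A \<noteq> C \<longrightarrow> (A - {p}) \<inter> (C - {p}) = {}"
    proof (intro ballI impI)
      fix A C assume "A \<in> ?Sp" "C \<in> ?Sp" "A \<noteq> C"
      then show "(A - {p}) \<inter> (C - {p}) = {}"
        using block_eqI[of A C p] S_subset by blast
    qed
  qed (use fin in auto)
  also have "\<dots> = (\<Sum>A\<in>?Sp. k - 1)"
    using card_block S_subset by (intro sum.cong) (auto simp: subset_iff)
  also have "\<dots> = k * (k - 1)" using assms(1) by (simp add: deg_def)
  finally have "card (\<Union>A\<in>?Sp. A - {p}) = k * (k - 1)" .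
  moreover have "finite (\<Union>A\<in>?Sp. A - {p})" using fin by blast
  moreover have "p \<notin> (\<Union>A\<in>?Sp. A - {p})" by blast
  ultimately have "card (\<Union>S) = k * (k - 1) + 1"
    unfolding U by (metis Suc_eq_plus1 card_insert_disjoint)
  then show ?thesis using k_gt_1 by (simp add: of_nat_diff)
qed

text \<open>A block of \<open>S\<close> has total defect \<open>c = q\<^sup>2 - |S|\<close>, where \<open>p\<close> has defect \<open>d = q - deg p\<close>;
  hence \<open>0 \<le> d \<le> c\<close>, and \<open>1 / (q - d)\<close> lies below its chord on \<open>[0, c]\<close>.\<close>

lemma covered_bound_of_deg_less:
  assumes deg: "\<And>p. p \<in> \<Union>S \<Longrightarrow> deg p < k" and "S \<noteq> {}"
  defines "q \<equiv> int k - 1" and "s \<equiv> int (card S)"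
  defines "c \<equiv> q\<^sup>2 - s"
  assumes "c < q"
  shows "0 \<le> c \<and> s * (q + 1) \<le> q * int (card (\<Union>S))
    \<and> (q - c) * int (card (\<Union>S)) \<le> s * (q - c + 1)"
proof -
  let ?d = "\<lambda>p. q - int (deg p)"
  have d0: "?d p \<ge> 0" if "p \<in> \<Union>S" for p using deg[OF that] by (simp add: q_def)
  have sumd: "(\<Sum>p\<in>B. ?d p) = c" if B: "B \<in> S" for B
  proof -
    have "B \<in> Bs" using B S_subset by blast
    then have "(\<Sum>p\<in>B. ?d p) = int k * q - (s - 1 + int k)"
      using sum_deg_block[OF B] card_block by (simp add: sum_subtractf s_def)
    also have "\<dots> = c" by (simp add: c_def q_def power2_eq_square algebra_simps)
    finally show ?thesis .
  qed
  have c0: "0 \<le> c"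
  proof -
    obtain B where B: "B \<in> S" using \<open>S \<noteq> {}\<close> by blast
    have "0 \<le> (\<Sum>p\<in>B. ?d p)" using d0 B by (intro sum_nonneg) blast
    then show ?thesis using sumd[OF B] by simp
  qed
  have dc: "?d p \<le> c" if p: "p \<in> \<Union>S" for p
  proof -
    obtain B where B: "B \<in> S" "p \<in> B" using p by blast
    have "finite B" using B S_subset finite_block by blast
    then have "?d p \<le> (\<Sum>p\<in>B. ?d p)"
      by (rule member_le_sum[OF B(2), rotated]) (use d0 B in auto)
    then show ?thesis using sumd[OF B(1)] by simp
  qed
  have "s * (q + 1) = (\<Sum>B\<in>S. \<Sum>p\<in>B. 1)"
    using card_block S_subset by (simp add: s_def q_def subset_iff)
  also have "\<dots> = (\<Sum>p\<in>\<Union>S. int (deg p) * 1)" by (rule sum_covered_deg[symmetric])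
  also have "\<dots> \<le> (\<Sum>p\<in>\<Union>S. q)" using d0 by (intro sum_mono) auto
  finally have lower: "s * (q + 1) \<le> q * int (card (\<Union>S))" by (simp add: mult.commute)
  \<comment> \<open>The chord bound with denominators cleared is
    \<open>q * (q - c) \<le> deg p * (q - c + d)\<close>, the gap being \<open>d * (c - d)\<close>.
    The factor \<open>deg p\<close> turns the sum over points into one over blocks, where the
    defects add up to \<open>c\<close>.\<close>
  have "q * ((q - c) * int (card (\<Union>S))) = (\<Sum>p\<in>\<Union>S. q * (q - c))" by simp
  also have "\<dots> \<le> (\<Sum>p\<in>\<Union>S. int (deg p) * (q - c + ?d p))"
  proof (rule sum_mono)
    fix p assume p: "p \<in> \<Union>S"
    have "int (deg p) * (q - c + ?d p) - q * (q - c) = ?d p * (c - ?d p)"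
      by (simp add: algebra_simps)
    moreover have "0 \<le> ?d p * (c - ?d p)" using d0[OF p] dc[OF p] by simp
    ultimately show "q * (q - c) \<le> int (deg p) * (q - c + ?d p)" by linarith
  qed
  also have "\<dots> = (\<Sum>B\<in>S. \<Sum>p\<in>B. q - c + ?d p)" by (rule sum_covered_deg)
  also have "\<dots> = (\<Sum>B\<in>S. int k * (q - c) + c)"
  proof (intro sum.cong refl)
    fix B assume B: "B \<in> S"
    then have "B \<in> Bs" using S_subset by blast
    then show "(\<Sum>p\<in>B. q - c + ?d p) = int k * (q - c) + c"
      using sumd[OF B] card_block by (simp only: sum.distrib) simp
  qed
  also have "\<dots> = q * (s * (q - c + 1))" by (simp add: s_def q_def algebra_simps)
  finally have "q * ((q - c) * int (card (\<Union>S))) \<le> q * (s * (q - c + 1))" .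
  moreover have "q > 0" using k_gt_1 by (simp add: q_def)
  ultimately show ?thesis using c0 lower by (simp only: mult_le_cancel_left_pos)
qed

end

section \<open>Integer inequalities for the two cases\<close>

text \<open>Dividing \<open>le\<close> by \<open>q\<close> and using
  \<open>N - s \<le> \<rho>\<close> leaves
  \<open>2 * (q\<^sup>2 - \<rho>) \<le> q\<^sup>2 - 1\<close>. With
  \<open>\<rho> \<le> 2 * q - 1\<close> this forces \<open>q = 3\<close> and
  \<open>\<rho> = 5\<close>; the undivided inequality then caps \<open>s\<close> at 8.\<close>

lemma deg_k_arith:
  fixes q R s N v :: int
  assumes "q \<ge> 3" "R \<ge> q\<^sup>2 - q + 2" "R \<le> q\<^sup>2 + q" "s \<ge> R"
    and N: "N = q\<^sup>2 + q + 1" and v: "v = R * q + 1"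
    and le: "2 * (N - R) * (v - N) \<le> (q - 1) * (N * (N - 1) - s * (q + 1) * q)"
  shows "q = 3 \<and> R = 8 \<and> s = 8"
proof -
  define \<rho> where "\<rho> = N - R"
  have \<rho>: "1 \<le> \<rho>" "\<rho> \<le> 2 * q - 1" using assms by (auto simp: \<rho>_def)
  have "2 * (N - R) * (v - N) = q * (2 * \<rho> * (q\<^sup>2 - \<rho>))"
    by (simp add: \<rho>_def v N power2_eq_square algebra_simps)
  moreover have "(q - 1) * (N * (N - 1) - s * (q + 1) * q) = q * ((q\<^sup>2 - 1) * (N - s))"
    by (simp add: N power2_eq_square algebra_simps)
  ultimately have main: "2 * \<rho> * (q\<^sup>2 - \<rho>) \<le> (q\<^sup>2 - 1) * (N - s)"
    using le assms(1) by simp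
  have q2: "q\<^sup>2 \<ge> 1" using assms(1) by (simp add: power2_eq_square) (smt (verit) mult_less_cancel_left2)
  then have "(q\<^sup>2 - 1) * (N - s) \<le> (q\<^sup>2 - 1) * \<rho>"
    using assms(4) by (intro mult_left_mono) (auto simp: \<rho>_def)
  then have "\<rho> * (2 * (q\<^sup>2 - \<rho>)) \<le> \<rho> * (q\<^sup>2 - 1)" using main by (simp add: mult_ac)
  then have half: "2 * (q\<^sup>2 - \<rho>) \<le> q\<^sup>2 - 1" using \<rho> by simp
  then have "(q - 1) * (q - 3) \<le> 0" using \<rho> by (simp add: power2_eq_square algebra_simps)
  then have q: "q = 3" using assms(1) by (smt (verit) mult_pos_pos)
  then have "\<rho> = 5" using half \<rho> by simp
  then show ?thesis using main q assms(4) N by (simp add: \<rho>_def)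
qed

text \<open>The last hypothesis is \<open>y\<close> at least 3/4 times the square root of k = q + 1,
  squared. For \<open>y\<^sup>2 \<ge> q + 1\<close> the bound
  \<open>2 * q + 1 - y \<ge> q + 1\<close> suffices; below that, small \<open>y\<close> leave only
  finitely many \<open>q\<close>.\<close>

lemma sqrt_threshold_arith:
  fixes q y :: int
  assumes "q \<ge> 3" "0 < y" "y \<le> q" "16 * y\<^sup>2 \<ge> 9 * (q + 1)"
  shows "q * (q + 1) < y\<^sup>2 * (2 * q + 1 - y)"
proof (cases "q + 1 \<le> y\<^sup>2")
  case True
  have "q * (q + 1) < (q + 1) * (q + 1)" using assms by simp
  also have "\<dots> \<le> y\<^sup>2 * (2 * q + 1 - y)" using True assms by (intro mult_mono) auto
  finally show ?thesis .
next
  case False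
  then have y2: "y\<^sup>2 \<le> q" by simp
  have "y \<noteq> 1" using assms by auto
  then consider "y = 2" | "y = 3" | "y \<ge> 4" using assms(2) by linarith
  then show ?thesis
  proof cases
    case 1
    \<comment> \<open>The threshold gives \<open>q \<le> 6\<close>, and \<open>y2\<close> excludes
      3. The case \<open>q = 6\<close> is tight: 42 < 44.\<close>
    then have "q \<in> {3..6}" using assms by auto
    then have "q = 3 \<or> q = 4 \<or> q = 5 \<or> q = 6" by auto
    then show ?thesis using 1 y2 by auto
  next
    case 2
    then have "9 \<le> q" "q \<le> 15" using assms y2 by auto
    then have "(q - 2) * (q - 15) \<le> 0" by (intro mult_nonneg_nonpos) auto
    then show ?thesis using 2 by (simp add: algebra_simps)
  next
    case 3
    \<comment> \<open>The target \<open>16 * q < 9 * (2 * q + 1 - y)\<close> says 2q - 9y + 9 > 0;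
      replacing \<open>q\<close> by its lower bound \<open>y\<^sup>2\<close> gives exactly this
      product.\<close>
    have "(2 * y - 3) * (y - 3) > 0" using 3 by simp
    then have "16 * q < 9 * (2 * q + 1 - y)" using y2 by (simp add: power2_eq_square algebra_simps)
    then have "16 * q * (q + 1) < 9 * (2 * q + 1 - y) * (q + 1)" using assms by (intro mult_strict_right_mono) auto
    also have "\<dots> = 9 * (q + 1) * (2 * q + 1 - y)" by (simp only: mult_ac)
    also have "\<dots> \<le> 16 * y\<^sup>2 * (2 * q + 1 - y)" using assms by (intro mult_right_mono) auto
    finally show ?thesis by simp
  qed
qed

text \<open>In terms of \<open>\<beta>\<close> and \<open>h\<close>, the difference of the two sides
  is a part free of \<open>h\<close> plus \<open>2 * h * t\<close>. The first part is positive by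
  \<open>thr\<close>, since \<open>y * \<beta> \<le> s\<close> and
  \<open>y * (\<beta> - 1) \<le> q * (q - 1)\<close>; the second is nonnegative.\<close>

lemma deg_less_arith:
  fixes q R s N v y :: int
  assumes q: "q \<ge> 3" and R: "R \<ge> q\<^sup>2 - q + 2" "R \<le> s"
    and s: "s = q\<^sup>2 - q + y" and y: "y \<le> q"
    and thr: "q * (q + 1) < y\<^sup>2 * (2 * q + 1 - y)"
    and N: "s * (q + 1) \<le> q * N" "y * N \<le> s * (y + 1)" and v: "v = R * q + 1"
  shows "(q - 1) * (N * (N - 1) - s * (q + 1) * q) < 2 * (N - R) * (v - N)"
proof -
  define \<beta> h where "\<beta> = N - s" and "h = s - R"
  have y2: "2 \<le> y" and h: "0 \<le> h" "h \<le> y - 2" using R s by (auto simp: h_def)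
  have qq: "0 < q * (q - 1)" using q by simp
  have s_pos: "0 < s" using qq s y2 by (simp add: power2_eq_square algebra_simps)
  have "0 < q * \<beta>" using N(1) s_pos by (simp add: \<beta>_def algebra_simps)
  then have \<beta>1: "1 \<le> \<beta>" using q by (simp add: zero_less_mult_iff)
  have \<beta>s: "y * \<beta> \<le> s" using N(2) by (simp add: \<beta>_def algebra_simps)
  have "y * \<beta> * (y * (\<beta> - 1)) \<le> s * (q * (q - 1))"
  proof (rule mult_mono[OF \<beta>s])
    show "y * (\<beta> - 1) \<le> q * (q - 1)"
      using \<beta>s s by (simp add: power2_eq_square algebra_simps)
  qed (use s_pos \<beta>1 y2 in auto)
  then have "(q + 1) * (y * \<beta> * (y * (\<beta> - 1))) \<le> (q + 1) * (s * (q * (q - 1)))"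
    using q by (intro mult_left_mono) auto
  also have "\<dots> = ((q - 1) * s) * (q * (q + 1))" by (simp add: algebra_simps)
  also have "\<dots> < ((q - 1) * s) * (y\<^sup>2 * (2 * q + 1 - y))"
    using thr q s_pos by (intro mult_strict_left_mono) auto
  finally have "y\<^sup>2 * ((q + 1) * (\<beta> * (\<beta> - 1))) < y\<^sup>2 * ((q - 1) * s * (2 * q + 1 - y))"
    by (simp add: power2_eq_square mult_ac)
  then have main: "(q + 1) * (\<beta> * (\<beta> - 1)) < (q - 1) * s * (2 * q + 1 - y)"
    by (rule mult_left_less_imp_less) simp
  define t where "t = s * (q - 1) + 1 - \<beta> * (q + 1) - q * h"
  \<comment> \<open>The factor \<open>y\<close> is needed because \<open>\<beta>\<close> is bounded
    only through \<open>y * \<beta> \<le> s\<close>. The product is then split into nonnegative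
    terms, one for each of the estimates on \<open>\<beta>\<close>, \<open>h\<close>,
    \<open>s\<close> and \<open>q\<close>.\<close>
  have "0 \<le> y * t"
  proof -
    have "y * \<beta> * (q + 1) \<le> s * (q + 1)" using \<beta>s q by (intro mult_right_mono) auto
    moreover have "q * y * h \<le> q * y * (y - 2)" using h q y2 by (intro mult_left_mono) auto
    moreover have "q * (q - 1) * ((y - 2) * (q - 1)) \<le> s * ((y - 2) * (q - 1))"
    proof (rule mult_right_mono)
      show "q * (q - 1) \<le> s" using s y2 by (simp add: power2_eq_square algebra_simps)
    qed (use y2 q in auto)
    moreover have "0 \<le> s * (q - 3)" using s_pos q by simp
    moreover have "0 \<le> q * (y - 2) * ((q - 1)\<^sup>2 - y)"
    proof -
      have "0 \<le> q * (q - 3)" using q by simp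
      then have "y \<le> (q - 1)\<^sup>2" using y by (simp add: power2_eq_square algebra_simps)
      then show ?thesis using q y2 by simp
    qed
    moreover have "y * t = (s * (q + 1) - y * \<beta> * (q + 1)) + (q * y * (y - 2) - q * y * h)
        + (s * ((y - 2) * (q - 1)) - q * (q - 1) * ((y - 2) * (q - 1)))
        + s * (q - 3) + q * (y - 2) * ((q - 1)\<^sup>2 - y) + y"
      by (simp add: t_def power2_eq_square algebra_simps)
    ultimately show ?thesis using y2 by linarith
  qed
  then have "0 \<le> t" using y2 by (simp add: zero_le_mult_iff)
  then have "0 \<le> 2 * h * t" using h by simp
  moreover have "2 * (N - R) * (v - N) - (q - 1) * (N * (N - 1) - s * (q + 1) * q)
      = ((q - 1) * s * (2 * q + 1 - y) - (q + 1) * (\<beta> * (\<beta> - 1))) + 2 * h * t"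
  proof -
    have e: "N = s + \<beta>" "R = s - h" "y = s - q\<^sup>2 + q" using s by (auto simp: \<beta>_def h_def)
    show ?thesis unfolding v t_def e by (simp add: power2_eq_square algebra_simps)
  qed
  ultimately show ?thesis using main by linarith
qed

section \<open>The size bound and its equality case\<close>

theorem theorem5p5:
  fixes P :: "'a set" and Bs S :: "'a set set" and v k :: nat and r :: real
  assumes "is_2_design v k P Bs"
    and "k \<ge> 4"
    and "r = (real v - 1) / (real k - 1)"
    and "erdos_ko_rado_set Bs S"
    and "r \<le> (real k)\<^sup>2 - real k"
    and "r \<ge> (real k)\<^sup>2 - 3 * real k + 3 / 4 * sqrt (real k) + 2"
  shows "real (card S) \<le> r \<and>
    ((r, k) \<noteq> (8, 4) \<longrightarrow>
      (real (card S) = r \<longleftrightarrow> (\<exists>p\<in>P. S = point_pencil Bs p)))"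
proof -
  interpret intersecting_family v k P Bs S
    using assms by unfold_locales
  have v_real: "real v = real rep * (real k - 1) + 1"
  proof -
    have "real_of_int (int v) = real_of_int (int rep * (int k - 1) + 1)" using v_eq by simp
    then show ?thesis by simp
  qed
  have r: "r = real rep" using assms(2,3) v_real by simp
  define q where "q = int k - 1"
  define R where "R = int rep"
  define s where "s = int (card S)"
  \<comment> \<open>Since \<open>q\<^sup>2 - q\<close> equals k^2 - 3k + 2, the lower bound on
    \<open>r\<close> says that \<open>z\<close> is at least 3/4 times the square root of
    \<open>k\<close>.\<close>
  define z where "z = R - (q\<^sup>2 - q)"
  have q3: "q \<ge> 3" and k_q: "int k = q + 1" using assms(2) by (auto simp: q_def)
  have v: "int v = R * q + 1" using v_eq by (simp add: R_def q_def)
  have R_upper: "R \<le> q\<^sup>2 + q"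
  proof -
    have "real_of_int R \<le> real_of_int (q\<^sup>2 + q)"
      using assms(5) r by (simp add: R_def q_def power2_eq_square algebra_simps)
    then show ?thesis by (simp only: of_int_le_iff)
  qed
  have z_real: "real_of_int z \<ge> 3 / 4 * sqrt (real k)"
    using assms(6) r by (simp add: z_def R_def q_def power2_eq_square algebra_simps)
  moreover have "0 < sqrt (real k)" using assms(2) by simp
  ultimately have "0 < real_of_int z" by linarith
  then have z_pos: "0 < z" by simp
  have z_sq: "9 * (q + 1) \<le> 16 * z\<^sup>2"
  proof -
    have "(3 / 4 * sqrt (real k))\<^sup>2 \<le> (real_of_int z)\<^sup>2"
      using z_real by (intro power_mono) auto
    then have "real_of_int (9 * (q + 1)) \<le> real_of_int (16 * z\<^sup>2)"
      by (simp add: power_mult_distrib power_divide q_def)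
    then show ?thesis by (simp only: of_int_le_iff)
  qed
  \<comment> \<open>Integrality improves the threshold: \<open>z = 1\<close> would need 16 \<ge> 9
    (q + 1), which fails for \<open>q \<ge> 3\<close>.\<close>
  have z2: "2 \<le> z"
  proof (rule ccontr)
    assume "\<not> 2 \<le> z"
    then have "z = 1" using z_pos by simp
    then show False using z_sq q3 by simp
  qed
  have bound: "2 * (int (card (\<Union>S)) - R) * (int v - int (card (\<Union>S)))
      \<le> (q - 1) * (int (card (\<Union>S)) * (int (card (\<Union>S)) - 1) - s * (q + 1) * q)"
    using outside_points_bound[OF S_subset] by (simp add: R_def s_def k_q)
  \<comment> \<open>A family outside every pencil can reach size r only for the exceptional
    parameters, and even there it does not exceed r.\<close>
  have key: "q = 3 \<and> R = 8 \<and> s = 8"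
    if big: "R \<le> s" and no_pencil: "\<And>p. p \<in> P \<Longrightarrow> \<not> S \<subseteq> point_pencil Bs p"
  proof -
    have miss: "\<exists>B\<in>S. p \<notin> B" if "p \<in> \<Union>S" for p
      using no_pencil[of p] that covered_subset S_subset by (auto simp: point_pencil_def)
    show ?thesis
    proof (cases "\<exists>p\<in>\<Union>S. deg p = k")
      case True
      then obtain p B where "deg p = k" "B \<in> S" "p \<notin> B" using miss by blast
      then have N: "int (card (\<Union>S)) = q\<^sup>2 + q + 1"
        using card_covered_of_deg_k by (simp add: k_q power2_eq_square algebra_simps)
      show ?thesis
        by (rule deg_k_arith[OF q3 _ R_upper big N v bound]) (use z2 z_def in simp)
    next
      case False
      have deg: "deg p < k" if "p \<in> \<Union>S" for p
        using miss[OF that] deg_le[of _ p] False that by (metis order.not_eq_order_implies_strict)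
      \<comment> \<open>This is \<open>z\<close> with \<open>s\<close> in place of \<open>R\<close>,
        so it inherits the threshold; it is also the number \<open>q - c\<close> of
        \<open>covered_bound_of_deg_less\<close>.\<close>
      define y where "y = q - (q\<^sup>2 - s)"
      have yz: "z \<le> y" using big by (simp add: y_def z_def)
      have "0 < q * (q - 1)" using q3 by simp
      then have "0 < s" using yz z_pos by (simp add: y_def power2_eq_square algebra_simps)
      then have "S \<noteq> {}" by (auto simp: s_def)
      then have cov: "y \<le> q" "s * (q + 1) \<le> q * int (card (\<Union>S))"
        "y * int (card (\<Union>S)) \<le> s * (y + 1)"
        using covered_bound_of_deg_less[OF deg] yz z_pos by (auto simp: y_def q_def s_def)
      have "z\<^sup>2 \<le> y\<^sup>2" using yz z_pos by (intro power_mono) auto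
      then have "q * (q + 1) < y\<^sup>2 * (2 * q + 1 - y)"
        using sqrt_threshold_arith[of q y] q3 yz z_pos cov(1) z_sq by linarith
      moreover have "R \<ge> q\<^sup>2 - q + 2" "s = q\<^sup>2 - q + y" using z2 by (auto simp: z_def y_def)
      \<comment> \<open>The strict inequality contradicts \<open>bound\<close>, so this case cannot
        occur.\<close>
      ultimately show ?thesis
        using deg_less_arith[of q R s y "int (card (\<Union>S))" "int v"] q3 big cov v bound by linarith
    qed
  qed
  have pencil: "finite (point_pencil Bs p)" "card (point_pencil Bs p) = rep" if "p \<in> P" for p
    using card_star_eq[OF that] finite_Bs by (auto simp: point_pencil_def)
  have le: "card S \<le> rep"
  proof (cases "\<exists>p\<in>P. S \<subseteq> point_pencil Bs p")
    case True
    then show ?thesis using pencil card_mono by metis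
  next
    case False
    \<comment> \<open>If \<open>card S\<close> exceeded \<open>rep\<close>, then \<open>key\<close>
      would apply and give \<open>R = s\<close>, a contradiction.\<close>
    then show ?thesis using key by (force simp: R_def s_def)
  qed
  moreover have "card S = rep \<longleftrightarrow> (\<exists>p\<in>P. S = point_pencil Bs p)" if ne: "(r, k) \<noteq> (8, 4)"
  proof
    assume eq: "card S = rep"
    have "\<not> (q = 3 \<and> R = 8 \<and> s = 8)" using ne r by (auto simp: q_def R_def)
    then obtain p where "p \<in> P" "S \<subseteq> point_pencil Bs p" using key eq by (auto simp: R_def s_def)
    then show "\<exists>p\<in>P. S = point_pencil Bs p" using pencil eq by (metis card_subset_eq)
  qed (use pencil in auto)
  ultimately show ?thesis using r by simp
qed

end
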